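(* Let $V$ be a vertex algebra, $M,N,W$ be $V$-modules, and $F_z:M\times N\to W((z))$ a $\mathbf k$-bilinear map. The following conditions on $F_z$ are equivalent. (1) $F_z(du,v)=\frac{d}{dz}F_z(u,v)$ and $F_z(u,dv)=(d-\frac{d}{dz})F_z(u,v)$ for all $u\in M,v\in N$; and for any $a\in V$, $u\in M$, $v\in N$ there exist $n,k\in\mathbb N$ such that $$(z+x)^n\,a_{\dot{z+x}}F_x(u,v)=(z+x)^n\,F_x(a_{\dot z}u,v),\qquad (z-x)^k\,a_{\dot z}F_x(u,v)=(z-x)^k\,F_x(u,a_{\dot z}v).$$ (2) $F_z(du,v)=\frac{d}{dz}F_z(u,v)$ and $F_z(u,dv)=(d-\frac{d}{dz})F_z(u,v)$ for all $u\in M,v\in N$; and for any $a\in V$, $u\in M$, $v\in N$ the two identities in (1) hold with $n=N_{a,v}$ and $k=N_{a,u}$. (3) $F_z(du,v)=\frac{d}{dz}F_z(u,v)$ and $F_z(u,dv)=(d-\frac{d}{dz})F_z(u,v)$ for all $u\in M,v\in N$; and for any $a\in V$, $u\in M$, $v\in N$ the two identities in (1) hold for some $n\in\mathbb N$ depending only on $a$ and $v$, and some $k\in\mathbb N$ depending only on $a$ and $u$. (4) $F_z$ is an intertwining operator of type $\binom{W}{M,N}$. (A map satisfying (1), equivalently (2) or (3), is called a vertex bilinear map of type $(M,N;W)$.)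
   Context: All vector spaces are over an algebraically closed field $\mathbf k$ of characteristic $0$. For $n\in\mathbb Z$, $(x+y)^n:=\sum_{k\ge 0}\binom nk x^{n-k}y^k$, i.e. binomials are expanded in nonnegative powers of the second-listed variable; a series evaluated at $z+x$, $x-y$, $-y+x$, etc. is expanded by this rule. $\delta(x,y):=\sum_{n\in\mathbb Z}x^ny^{-n-1}$, so $\delta(x-y,z)=\sum_n (x-y)^nz^{-n-1}$, etc. Vertex algebra: a vector space $V$ with a linear map $V\otimes V\to V((z))$, $a\otimes b\mapsto a_{\dot z}b=\sum_{n}(a_nb)z^{-n-1}$, a vector $\mathbf 1\in V$ and $d\in\mathrm{End}(V)$ such that for $a,b,c\in V$: $\mathbf 1_{\dot z}a=a$, $a_{\dot z}\mathbf 1=e^{zd}a$; $(da)_{\dot z}b=\frac{d}{dz}(a_{\dot z}b)$, $d(a_{\dot z}b)=(da)_{\dot z}b+a_{\dot z}(db)$; $a_{\dot z}b=e^{zd}(b_{\dot{-z}}a)$; and there is $l\in\mathbb N$ with $(z+w)^l(a_{\dot z}b)_{\dot w}c=(z+w)^l a_{\dot{z+w}}(b_{\dot w}c)$. $V$-module: a vector space $M$ with $d\in\mathrm{End}(M)$ and a linear map $V\otimes M\to M((z))$, $a\otimes u\mapsto a_{\dot z}u=\sum_n(a_nu)z^{-n-1}$, such that $\mathbf 1_{\dot z}u=u$; $(da)_{\dot z}u=\frac{d}{dz}(a_{\dot z}u)$, $d(a_{\dot z}u)=(da)_{\dot z}u+a_{\dot z}(du)$; and for all $a,b\in V$, $u\in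 M$ there is $l\in\mathbb N$ with $(z+x)^l(a_{\dot z}b)_{\dot x}u=(z+x)^la_{\dot{z+x}}(b_{\dot x}u)$. For $a\in V$ and $u$ in a $V$-module $M$, $N_{a,u}$ denotes the minimum positive integer such that $z^{N_{a,u}}(a_{\dot z}u)\in M[[z]]$. Intertwining operator of type $\binom{W}{M,N}$: a bilinear map $I_z:M\times N\to W((z))$ with $I_z(du,v)=\frac{d}{dz}I_z(u,v)$, $d(I_z(u,v))=I_z(du,v)+I_z(u,dv)$ and, for all $a\in V$, $u\in M$, $v\in N$, $\delta(x-y,z)\,a_{\dot x}I_y(u,v)-\delta(-y+x,z)\,I_y(u,a_{\dot x}v)=\delta(x-z,y)\,I_y(a_{\dot z}u,v)$. *)

theory Defs
  imports Complex_Main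
    "HOL-Computational_Algebra.Formal_Laurent_Series"
    "HOL-Library.Groups_Big_Fun"
    "HOL-Library.Product_Plus"
begin

text \<open>
  A vector space over \<open>'k\<close> is a type with a scalar multiplication \<open>s\<close> satisfying
  \<open>vector_space s\<close>. The space \<open>W((z))\<close> is \<open>'w fls\<close>, and \<open>fls_nth f n\<close> is the coefficient of
  \<open>z^n\<close>; thus \<open>a_n b\<close> is \<open>fls_nth (Y a b) (- n - 1)\<close>.
  Doubly infinite formal series in several variables are coefficient functions on
  exponents: \<open>int \<Rightarrow> 'w\<close>, \<open>int \<times> int \<Rightarrow> 'w\<close>, \<open>int \<times> int \<times> int \<Rightarrow> 'w\<close>.

  The sums \<open>Sum_any\<close> below are over finitely supported families whenever the maps involved
  are bilinear with values in Laurent series (\<open>Sum_any\<close> is \<open>0\<close> on an infinitely supported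
  family). This is proved at the end for the sums that are not visibly finite.
\<close>

text \<open>
  \<open>binom_exp \<alpha> \<beta> n (i, j)\<close> is the coefficient of \<open>x^i y^j\<close> in \<open>(\<alpha> x + \<beta> y)^n\<close>, expanded in
  nonnegative powers of the second-listed variable \<open>y\<close>.
\<close>

definition binom_exp :: "'k \<Rightarrow> 'k \<Rightarrow> int \<Rightarrow> int \<times> int \<Rightarrow> 'k::field_char_0" where
  "binom_exp \<alpha> \<beta> n = (\<lambda>(i, j).
     if 0 \<le> j \<and> i + j = n
     then (of_int n gchoose nat j) * power_int \<alpha> i * power_int \<beta> j else 0)"

text \<open>
  \<open>delta_exp \<alpha> \<beta> (i, j) k\<close> is the coefficient of \<open>x^i y^j z^k\<close> in \<open>\<delta>(\<alpha> x + \<beta> y, z)\<close>, which is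
  the sum over all integers \<open>n\<close> of \<open>(\<alpha> x + \<beta> y)^n z^(- n - 1)\<close>.
\<close>

definition delta_exp :: "'k \<Rightarrow> 'k \<Rightarrow> int \<times> int \<Rightarrow> int \<Rightarrow> 'k::field_char_0" where
  "delta_exp \<alpha> \<beta> p k = binom_exp \<alpha> \<beta> (- k - 1) p"

text \<open>The product of a scalar series and a vector series.\<close>

definition series_mult ::
    "('k \<Rightarrow> 'w \<Rightarrow> 'w) \<Rightarrow> ('i \<Rightarrow> 'k) \<Rightarrow> ('i \<Rightarrow> 'w) \<Rightarrow> 'i::ab_group_add \<Rightarrow> 'w::comm_monoid_add" where
  "series_mult s f g = (\<lambda>p. Sum_any (\<lambda>q. s (f q) (g (p - q))))"

definition series_deriv :: "('k::field_char_0 \<Rightarrow> 'w \<Rightarrow> 'w) \<Rightarrow> 'w::zero fls \<Rightarrow> int \<Rightarrow> 'w" where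
  "series_deriv s f = (\<lambda>n. s (of_int (n + 1)) (fls_nth f (n + 1)))"

text \<open>\<open>e^(z d) f(z)\<close>\<close>

definition exp_act ::
    "('k::field_char_0 \<Rightarrow> 'w \<Rightarrow> 'w) \<Rightarrow> ('w \<Rightarrow> 'w) \<Rightarrow> (int \<Rightarrow> 'w) \<Rightarrow> int \<Rightarrow> 'w::comm_monoid_add" where
  "exp_act s d f = (\<lambda>n. Sum_any (\<lambda>k::nat. s (inverse (fact k)) ((d ^^ k) (f (n - int k)))))"

text \<open>
  \<open>shift_act s Y a g\<close> is the series \<open>a_(z + x) g(x)\<close>, at \<open>(i, j)\<close> the coefficient of \<open>z^i x^j\<close>:
  it is the sum over \<open>m\<close> and \<open>l\<close> of \<open>(z + x)^m x^l\<close> times the coefficient of \<open>z^m\<close> in \<open>a_z g_l\<close>.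
\<close>

definition shift_act ::
    "('k::field_char_0 \<Rightarrow> 'w \<Rightarrow> 'w) \<Rightarrow> ('v \<Rightarrow> 'w \<Rightarrow> 'w fls) \<Rightarrow> 'v \<Rightarrow> 'w fls \<Rightarrow> int \<times> int \<Rightarrow> 'w::comm_monoid_add"
  where
  "shift_act s Y a g = (\<lambda>(i, j).
     Sum_any (\<lambda>(m, l). s (binom_exp 1 1 m (i, j - l)) (fls_nth (Y a (fls_nth g l)) m)))"

text \<open>Bilinearity of a map into \<open>W((z))\<close>, whose vector space structure is coefficientwise.\<close>

definition bilinear_series ::
    "('k::field \<Rightarrow> 'a \<Rightarrow> 'a) \<Rightarrow> ('k \<Rightarrow> 'b \<Rightarrow> 'b) \<Rightarrow> ('k \<Rightarrow> 'w \<Rightarrow> 'w) \<Rightarrow>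
     ('a::ab_group_add \<Rightarrow> 'b::ab_group_add \<Rightarrow> 'w::ab_group_add fls) \<Rightarrow> bool" where
  "bilinear_series sA sB sW F \<longleftrightarrow>
     (\<forall>b n. Vector_Spaces.linear sA sW (\<lambda>a. fls_nth (F a b) n)) \<and>
     (\<forall>a n. Vector_Spaces.linear sB sW (\<lambda>b. fls_nth (F a b) n))"

text \<open>
  \<open>(z + x)^n a_(z + x) F_x(u, v) = (z + x)^n F_x(a_z u, v)\<close>, with exponents of \<open>(z, x)\<close>.
  \<open>YM\<close> is the action on the first argument, \<open>YW\<close> the one on the values.
\<close>

definition associativity_id ::
    "('k::field_char_0 \<Rightarrow> 'w \<Rightarrow> 'w::comm_monoid_add) \<Rightarrow> ('v \<Rightarrow> 'm \<Rightarrow> 'm fls) \<Rightarrow> ('v \<Rightarrow> 'w \<Rightarrow> 'w fls) \<Rightarrow>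
     ('m::zero \<Rightarrow> 'n \<Rightarrow> 'w fls) \<Rightarrow> nat \<Rightarrow> 'v \<Rightarrow> 'm \<Rightarrow> 'n \<Rightarrow> bool" where
  "associativity_id s YM YW F n a u v \<longleftrightarrow>
     series_mult s (binom_exp 1 1 (int n)) (shift_act s YW a (F u v)) =
     series_mult s (binom_exp 1 1 (int n)) (\<lambda>(i, j). fls_nth (F (fls_nth (YM a u) i) v) j)"

text \<open>\<open>(z - x)^k a_z F_x(u, v) = (z - x)^k F_x(u, a_z v)\<close>, with exponents of \<open>(z, x)\<close>.\<close>

definition locality_id ::
    "('k::field_char_0 \<Rightarrow> 'w \<Rightarrow> 'w::comm_monoid_add) \<Rightarrow> ('v \<Rightarrow> 'n \<Rightarrow> 'n fls) \<Rightarrow> ('v \<Rightarrow> 'w \<Rightarrow> 'w fls) \<Rightarrow>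
     ('m \<Rightarrow> 'n::zero \<Rightarrow> 'w fls) \<Rightarrow> nat \<Rightarrow> 'v \<Rightarrow> 'm \<Rightarrow> 'n \<Rightarrow> bool" where
  "locality_id s YN YW F k a u v \<longleftrightarrow>
     series_mult s (binom_exp 1 (-1) (int k)) (\<lambda>(i, j). fls_nth (YW a (fls_nth (F u v) j)) i) =
     series_mult s (binom_exp 1 (-1) (int k)) (\<lambda>(i, j). fls_nth (F u (fls_nth (YN a v) i)) j)"

text \<open>
  \<open>vac_right\<close> is \<open>a_z 1 = e^(z d) a\<close>, \<open>skew_symmetry\<close> is \<open>a_z b = e^(z d) (b_(-z) a)\<close>, and
  \<open>associativity\<close> is \<open>(z + w)^l (a_z b)_w c = (z + w)^l a_(z + w) (b_w c)\<close>.
\<close>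

locale vertex_algebra = vector_space sV
  for sV :: "'k::{alg_closed_field, field_char_0} \<Rightarrow> 'v::ab_group_add \<Rightarrow> 'v" +
  fixes Y :: "'v \<Rightarrow> 'v \<Rightarrow> 'v fls" and vac :: 'v and d :: "'v \<Rightarrow> 'v"
  assumes bilinear: "bilinear_series sV sV sV Y"
    and d_linear: "Vector_Spaces.linear sV sV d"
    and vac_left: "Y vac a = fls_const a"
    and vac_right: "fls_nth (Y a vac) = exp_act sV d (fls_nth (fls_const a))"
    and deriv_left: "fls_nth (Y (d a) b) = series_deriv sV (Y a b)"
    and deriv: "d (fls_nth (Y a b) n) = fls_nth (Y (d a) b) n + fls_nth (Y a (d b)) n"
    and skew_symmetry:
      "fls_nth (Y a b) = exp_act sV d (\<lambda>n. sV (power_int (-1) n) (fls_nth (Y b a) n))"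
    and associativity: "\<exists>l. associativity_id sV Y Y Y l a b c"

locale vertex_module =
  V: vertex_algebra sV Y vac dV + vector_space sM
  for sV :: "'k::{alg_closed_field, field_char_0} \<Rightarrow> 'v::ab_group_add \<Rightarrow> 'v"
    and Y :: "'v \<Rightarrow> 'v \<Rightarrow> 'v fls" and vac :: 'v and dV :: "'v \<Rightarrow> 'v"
    and sM :: "'k \<Rightarrow> 'm::ab_group_add \<Rightarrow> 'm" +
  fixes YM :: "'v \<Rightarrow> 'm \<Rightarrow> 'm fls" and d :: "'m \<Rightarrow> 'm"
  assumes bilinear: "bilinear_series sV sM sM YM"
    and d_linear: "Vector_Spaces.linear sM sM d"
    and vac_left: "YM vac u = fls_const u"
    and deriv_left: "fls_nth (YM (dV a) u) = series_deriv sM (YM a u)"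
    and deriv: "d (fls_nth (YM a u) n) = fls_nth (YM (dV a) u) n + fls_nth (YM a (d u)) n"
    and associativity: "\<exists>l. associativity_id sM Y YM YM l a b u"

text \<open>\<open>N_(a,u)\<close>; the inner condition says that \<open>z^N (a_z u)\<close> lies in \<open>M[[z]]\<close>.\<close>

definition pole_bound :: "('v \<Rightarrow> 'm \<Rightarrow> 'm::zero fls) \<Rightarrow> 'v \<Rightarrow> 'm \<Rightarrow> nat" where
  "pole_bound YM a u = (LEAST N. 0 < N \<and> (\<forall>n. n + int N < 0 \<longrightarrow> fls_nth (YM a u) n = 0))"

text \<open>
  The Jacobi identity
  \<open>\<delta>(x - y, z) a_x I_y(u, v) - \<delta>(- y + x, z) I_y(u, a_x v) = \<delta>(x - z, y) I_y(a_z u, v)\<close>;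
  the triple \<open>(i, j, k)\<close> holds the exponents of \<open>x\<close>, \<open>y\<close> and \<open>z\<close>.
\<close>

definition jacobi_id ::
    "('k::field_char_0 \<Rightarrow> 'w \<Rightarrow> 'w::ab_group_add) \<Rightarrow> ('v \<Rightarrow> 'm \<Rightarrow> 'm fls) \<Rightarrow> ('v \<Rightarrow> 'n \<Rightarrow> 'n fls) \<Rightarrow>
     ('v \<Rightarrow> 'w \<Rightarrow> 'w fls) \<Rightarrow> ('m::zero \<Rightarrow> 'n::zero \<Rightarrow> 'w fls) \<Rightarrow> 'v \<Rightarrow> 'm \<Rightarrow> 'n \<Rightarrow> bool" where
  "jacobi_id s YM YN YW I a u v \<longleftrightarrow>
     (\<forall>p. series_mult s (\<lambda>(i, j, k). delta_exp 1 (-1) (i, j) k)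
            (\<lambda>(i, j, k). if k = 0 then fls_nth (YW a (fls_nth (I u v) j)) i else 0) p
        - series_mult s (\<lambda>(i, j, k). delta_exp (-1) 1 (j, i) k)
            (\<lambda>(i, j, k). if k = 0 then fls_nth (I u (fls_nth (YN a v) i)) j else 0) p
        = series_mult s (\<lambda>(i, j, k). delta_exp 1 (-1) (i, k) j)
            (\<lambda>(i, j, k). if i = 0 then fls_nth (I (fls_nth (YM a u) k) v) j else 0) p)"

definition intertwining_operator ::
    "('k::field_char_0 \<Rightarrow> 'm \<Rightarrow> 'm) \<Rightarrow> ('v \<Rightarrow> 'm \<Rightarrow> 'm fls) \<Rightarrow> ('m \<Rightarrow> 'm) \<Rightarrow>
     ('k \<Rightarrow> 'n \<Rightarrow> 'n) \<Rightarrow> ('v \<Rightarrow> 'n \<Rightarrow> 'n fls) \<Rightarrow> ('n \<Rightarrow> 'n) \<Rightarrow>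
     ('k \<Rightarrow> 'w \<Rightarrow> 'w) \<Rightarrow> ('v \<Rightarrow> 'w \<Rightarrow> 'w fls) \<Rightarrow> ('w \<Rightarrow> 'w) \<Rightarrow>
     ('m::ab_group_add \<Rightarrow> 'n::ab_group_add \<Rightarrow> 'w::ab_group_add fls) \<Rightarrow> bool" where
  "intertwining_operator sM YM dM sN YN dN sW YW dW I \<longleftrightarrow>
     bilinear_series sM sN sW I \<and>
     (\<forall>u v. fls_nth (I (dM u) v) = series_deriv sW (I u v)) \<and>
     (\<forall>u v n. dW (fls_nth (I u v) n) = fls_nth (I (dM u) v) n + fls_nth (I u (dN v)) n) \<and>
     (\<forall>a u v. jacobi_id sW YM YN YW I a u v)"

text \<open>\<open>F_z(d u, v) = d/dz F_z(u, v)\<close> and \<open>F_z(u, d v) = (d - d/dz) F_z(u, v)\<close>\<close>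

definition derivation_compatible ::
    "('k::field_char_0 \<Rightarrow> 'w \<Rightarrow> 'w) \<Rightarrow> ('m \<Rightarrow> 'm) \<Rightarrow> ('n \<Rightarrow> 'n) \<Rightarrow> ('w \<Rightarrow> 'w) \<Rightarrow>
     ('m \<Rightarrow> 'n \<Rightarrow> 'w::ab_group_add fls) \<Rightarrow> bool" where
  "derivation_compatible sW dM dN dW F \<longleftrightarrow>
     (\<forall>u v. fls_nth (F (dM u) v) = series_deriv sW (F u v)) \<and>
     (\<forall>u v n. fls_nth (F u (dN v)) n = dW (fls_nth (F u v) n) - series_deriv sW (F u v) n)"


subsection \<open>Finiteness of the sums\<close>

lemma linear_imp_zero: "Vector_Spaces.linear s1 s2 f \<Longrightarrow> f 0 = 0"
  by (metis Vector_Spaces.linear_def module_hom.zero)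

lemma bilinear_series_zero:
  assumes "bilinear_series sA sB sW F"
  shows "fls_nth (F 0 b) n = 0" "fls_nth (F a 0) n = 0"
  using assms linear_imp_zero[of sA sW "\<lambda>a. fls_nth (F a b) n"]
    linear_imp_zero[of sB sW "\<lambda>b. fls_nth (F a b) n"]
  unfolding bilinear_series_def by auto

lemma bilinear_series_scale_zero:
  assumes "bilinear_series sA sB sW F"
  shows "sW 0 w = 0" "sW c 0 = 0"
proof -
  have "vector_space sW"
    using assms unfolding bilinear_series_def Vector_Spaces.linear_def by blast
  then interpret vector_space sW .
  show "sW 0 w = 0" "sW c 0 = 0" by auto
qed

lemma finite_binom_exp_power: "finite {p. binom_exp \<alpha> \<beta> (int n) p \<noteq> 0}"
proof (rule finite_subset)
  show "{p. binom_exp \<alpha> \<beta> (int n) p \<noteq> 0} \<subseteq> {0..int n} \<times> {0..int n}"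
  proof
    fix p assume "p \<in> {p. binom_exp \<alpha> \<beta> (int n) p \<noteq> 0}"
    then obtain i j where p: "p = (i, j)" "0 \<le> j" "i + j = int n" "(of_int (int n) :: 'a) gchoose nat j \<noteq> 0"
      by (cases p) (auto simp: binom_exp_def split: if_splits)
    then have "nat j \<le> n"
      by (metis binomial_eq_0 binomial_gbinomial not_le of_int_of_nat_eq of_nat_0)
    with p show "p \<in> {0..int n} \<times> {0..int n}" by auto
  qed
qed auto

lemma finite_shift_act:
  assumes "bilinear_series sV sW sW Y"
  shows "finite {(m, l). sW (binom_exp 1 1 m (i, j - l)) (fls_nth (Y a (fls_nth g l)) m) \<noteq> 0}"
proof (rule finite_subset)
  show "{(m, l). sW (binom_exp 1 1 m (i, j - l)) (fls_nth (Y a (fls_nth g l)) m) \<noteq> 0}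
      \<subseteq> (\<lambda>l. (i + (j - l), l)) ` {fls_subdegree g..j}"
  proof clarify
    fix m l assume *: "sW (binom_exp 1 1 m (i, j - l)) (fls_nth (Y a (fls_nth g l)) m) \<noteq> 0"
    then have "m = i + (j - l)" "l \<le> j"
      by (auto simp: binom_exp_def bilinear_series_scale_zero[OF assms] split: if_splits)
    moreover have "fls_nth g l \<noteq> 0"
      using * by (auto simp: bilinear_series_zero[OF assms] bilinear_series_scale_zero[OF assms])
    then have "fls_subdegree g \<le> l" by (rule fls_subdegree_leI)
    ultimately show "(m, l) \<in> (\<lambda>l. (i + (j - l), l)) ` {fls_subdegree g..j}" by auto
  qed
qed auto

lemma finite_exp_act:
  assumes "Vector_Spaces.linear s s d"
  shows "finite {k::nat. s (inverse (fact k)) ((d ^^ k) (s (c k) (fls_nth f (n - int k)))) \<noteq> 0}"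
proof (rule finite_subset)
  interpret vector_space s using assms by (simp add: Vector_Spaces.linear_def)
  have "(d ^^ k) 0 = 0" for k by (induction k) (auto simp: linear_imp_zero[OF assms])
  then have "fls_nth f (n - int k) \<noteq> 0"
    if "s (inverse (fact k)) ((d ^^ k) (s (c k) (fls_nth f (n - int k)))) \<noteq> 0" for k
    using that by auto
  then show "{k. s (inverse (fact k)) ((d ^^ k) (s (c k) (fls_nth f (n - int k)))) \<noteq> 0}
      \<subseteq> {..nat (n - fls_subdegree f)}"
    by (force dest: fls_subdegree_leI)
qed auto

text \<open>The three products in the Jacobi identity, in the order in which they occur.\<close>

lemma finite_jacobi:
  fixes p :: "int \<times> int \<times> int"
  assumes I: "bilinear_series sM sN sW I" and YW: "bilinear_series sV sW sW YW"
  shows "finite {q. sW ((\<lambda>(i, j, k). delta_exp 1 (-1) (i, j) k) q)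
      ((\<lambda>(i, j, k). if k = 0 then fls_nth (YW a (fls_nth (I u v) j)) i else 0) (p - q)) \<noteq> 0}"
    (is "finite ?A")
    and "finite {q. sW ((\<lambda>(i, j, k). delta_exp (-1) 1 (j, i) k) q)
      ((\<lambda>(i, j, k). if k = 0 then fls_nth (I u (fls_nth (YN a v) i)) j else 0) (p - q)) \<noteq> 0}"
    (is "finite ?B")
    and "finite {q. sW ((\<lambda>(i, j, k). delta_exp 1 (-1) (i, k) j) q)
      ((\<lambda>(i, j, k). if i = 0 then fls_nth (I (fls_nth (YM a u) k) v) j else 0) (p - q)) \<noteq> 0}"
    (is "finite ?C")
proof -
  obtain p1 p2 p3 where p: "p = (p1, p2, p3)" by (cases p)
  note simps = p delta_exp_def binom_exp_def bilinear_series_scale_zero[OF I]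
    bilinear_series_zero[OF I] bilinear_series_zero[OF YW]
  have "?A \<subseteq> (\<lambda>j. (- p3 - 1 - j, j, p3)) ` {0..p2 - fls_subdegree (I u v)}"
  proof
    fix q assume "q \<in> ?A"
    moreover obtain i j k where q: "q = (i, j, k)" by (cases q)
    ultimately have *: "(i, j, k) \<in> ?A" by simp
    then have "0 \<le> j" "i + j = - k - 1" "p3 = k"
      by (auto simp: simps split: if_splits)
    moreover have "fls_nth (I u v) (p2 - j) \<noteq> 0"
      using * by (auto simp: simps split: if_splits)
    then have "fls_subdegree (I u v) \<le> p2 - j" by (rule fls_subdegree_leI)
    ultimately show "q \<in> (\<lambda>j. (- p3 - 1 - j, j, p3)) ` {0..p2 - fls_subdegree (I u v)}"
      unfolding q by (intro rev_image_eqI[of j]) auto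
  qed
  then show "finite ?A" by (rule finite_subset) auto
  have "?B \<subseteq> (\<lambda>i. (i, - p3 - 1 - i, p3)) ` {0..p1 - fls_subdegree (YN a v)}"
  proof
    fix q assume "q \<in> ?B"
    moreover obtain i j k where q: "q = (i, j, k)" by (cases q)
    ultimately have *: "(i, j, k) \<in> ?B" by simp
    then have "0 \<le> i" "j + i = - k - 1" "p3 = k"
      by (auto simp: simps split: if_splits)
    moreover have "fls_nth (YN a v) (p1 - i) \<noteq> 0"
      using * by (auto simp: simps split: if_splits)
    then have "fls_subdegree (YN a v) \<le> p1 - i" by (rule fls_subdegree_leI)
    ultimately show "q \<in> (\<lambda>i. (i, - p3 - 1 - i, p3)) ` {0..p1 - fls_subdegree (YN a v)}"
      unfolding q by (intro rev_image_eqI[of i]) auto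
  qed
  then show "finite ?B" by (rule finite_subset) auto
  have "?C \<subseteq> (\<lambda>k. (p1, - p1 - k - 1, k)) ` {0..p3 - fls_subdegree (YM a u)}"
  proof
    fix q assume "q \<in> ?C"
    moreover obtain i j k where q: "q = (i, j, k)" by (cases q)
    ultimately have *: "(i, j, k) \<in> ?C" by simp
    then have "0 \<le> k" "i + k = - j - 1" "p1 = i"
      by (auto simp: simps split: if_splits)
    moreover have "fls_nth (YM a u) (p3 - k) \<noteq> 0"
      using * by (auto simp: simps split: if_splits)
    then have "fls_subdegree (YM a u) \<le> p3 - k" by (rule fls_subdegree_leI)
    ultimately show "q \<in> (\<lambda>k. (p1, - p1 - k - 1, k)) ` {0..p3 - fls_subdegree (YM a u)}"
      unfolding q by (intro rev_image_eqI[of k]) auto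
  qed
  then show "finite ?C" by (rule finite_subset) auto
qed

end

theory Submission
  imports Defs
begin

text \<open>
  By Pascal's rule each of the three products \<open>T\<close> in the Jacobi identity is annihilated by
  \<open>x - y - z\<close>. Hence the coefficients of \<open>z^(- k - 1)\<close> in the first two are the two sides of the
  locality identity with exponent \<open>k\<close>, and the coefficients of \<open>x^(- n - 1)\<close> in the first and
  the third are the two sides of the associativity identity with exponent \<open>n\<close>. The third product
  has no powers of \<open>z\<close> below \<open>z^(- N_(a,u))\<close> and the second none of \<open>x\<close> below
  \<open>x^(- N_(a,v))\<close>. So Jacobi gives (2). Conversely, under (1) the defect of the Jacobi identity
  vanishes for very negative exponents of \<open>z\<close> and of \<open>x\<close>, and a series annihilated by
  \<open>x - y - z\<close> with this property is zero: its coefficient at \<open>x^i y^j z^k\<close> is the difference of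
  those at \<open>x^(i - 1) y^(j + 1) z^k\<close> and \<open>x^i y^(j + 1) z^(k - 1)\<close>, so induct on \<open>i + k\<close>.
\<close>

section \<open>Finitely supported sums and powers of \<open>\<alpha> x + \<beta> y\<close>\<close>

text \<open>The support of \<open>f\<close> is the injective image of the support on the right; if
  it is infinite, both sides take the default value \<open>0\<close>.\<close>

lemma Sum_any_reindex_inj:
  assumes "inj h" and "\<And>x. x \<notin> range h \<Longrightarrow> f x = 0"
  shows "Sum_any f = Sum_any (\<lambda>x. f (h x))"
proof -
  have "{x. f x \<noteq> 0} = h ` {x. f (h x) \<noteq> 0}"
    using assms(2) by (auto simp: image_iff) (metis rangeE)
  then show ?thesis
    using assms(1) by (simp add: Sum_any.expand_set sum.reindex inj_on_subset[OF _ subset_UNIV])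
qed

lemma Sum_any_single:
  assumes "\<And>x. x \<noteq> a \<Longrightarrow> f x = 0"
  shows "Sum_any f = f a"
proof -
  have "Sum_any f = sum f {a}"
    by (rule Sum_any.expand_superset) (use assms in auto)
  then show ?thesis by simp
qed

lemma Sum_any_eq_0: "(\<And>x. f x = 0) \<Longrightarrow> Sum_any f = 0"
  by (simp add: Sum_any.expand_set)

text \<open>Pascal's rule holds for every integer upper index, so multiplying by
  \<open>\<alpha> x + \<beta> y\<close> raises the exponent by one for negative \<open>n\<close> as
  well.\<close>

lemma binom_exp_add_one:
  fixes \<alpha> \<beta> :: "'k::field_char_0"
  assumes "\<alpha> \<noteq> 0" "\<beta> \<noteq> 0"
  shows "binom_exp \<alpha> \<beta> (n + 1) (i, j) =
    \<alpha> * binom_exp \<alpha> \<beta> n (i - 1, j) + \<beta> * binom_exp \<alpha> \<beta> n (i, j - 1)"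
proof -
  have \<alpha>: "power_int \<alpha> i = \<alpha> * power_int \<alpha> (i - 1)"
    using assms power_int_add_1'[of \<alpha> "i - 1"] by simp
  consider "j < 0 \<or> i + j \<noteq> n + 1" | "j = 0" "i = n + 1" | m where "j = int (Suc m)" "i = n - int m"
  proof (cases "j \<le> 0 \<or> i + j \<noteq> n + 1")
    case False
    then have "j = int (Suc (nat (j - 1)))" by simp
    with False show ?thesis by (intro that(3)[of "nat (j - 1)"]) auto
  qed (use that(1,2) in force)
  then show ?thesis
  proof cases
    case 3
    have "power_int \<beta> j = \<beta> * power_int \<beta> (j - 1)"
      using assms power_int_add_1'[of \<beta> "j - 1"] by simp
    moreover have "nat (1 + int m) = Suc m" "nat (int m) = m" by auto
    ultimately show ?thesis
      using 3 gbinomial_Suc_Suc[of "of_int n :: 'k" m] \<alpha>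
      by (simp add: binom_exp_def algebra_simps)
  qed (use \<alpha> in \<open>auto simp: binom_exp_def\<close>)
qed

lemma binom_exp_0:
  "binom_exp \<alpha> \<beta> 0 p = (if p = (0, 0) then 1 else (0::'k::field_char_0))"
  by (cases p) (auto simp: binom_exp_def gbinomial_0_left)

text \<open>Moves a monomial factor onto the scalar series, so that recurrences of the latter carry
  over to the product.\<close>

lemma series_mult_shift:
  "series_mult s f g (p - e) = series_mult s (\<lambda>q. f (q - e)) g p"
proof -
  have "Sum_any (\<lambda>q. s (f (q - e)) (g (p - q))) = Sum_any (\<lambda>q. s (f (q + e - e)) (g (p - (q + e))))"
    by (rule Sum_any_reindex_inj) (auto simp: inj_def surj_plus_right)
  then show ?thesis
    by (simp add: series_mult_def algebra_simps)
qed

context vector_space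
begin

lemma series_mult_add:
  assumes "finite {q. scale (f q) (g (p - q)) \<noteq> 0}" "finite {q. scale (f' q) (g (p - q)) \<noteq> 0}"
  shows "series_mult scale (\<lambda>q. f q + f' q) g p = series_mult scale f g p + series_mult scale f' g p"
  using Sum_any.distrib[OF assms] by (simp add: series_mult_def scale_left_distrib)

lemma series_mult_scale:
  assumes "finite {q. f q \<noteq> 0}"
  shows "series_mult scale (\<lambda>q. c * f q) g p = scale c (series_mult scale f g p)"
proof -
  have "series_mult scale (\<lambda>q. c * f q) g p = (\<Sum>q | f q \<noteq> 0. scale (c * f q) (g (p - q)))"
    unfolding series_mult_def by (rule Sum_any.expand_superset) (use assms in auto)
  also have "\<dots> = scale c (\<Sum>q | f q \<noteq> 0. scale (f q) (g (p - q)))"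
    by (simp add: scale_sum_right)
  also have "(\<Sum>q | f q \<noteq> 0. scale (f q) (g (p - q))) = series_mult scale f g p"
    unfolding series_mult_def by (rule Sum_any.expand_superset[symmetric]) (use assms in auto)
  finally show ?thesis .
qed

end

text \<open>\<open>G n\<close> arises from \<open>G 0\<close> by \<open>n\<close> multiplications
  with \<open>\<alpha> x + \<beta> y\<close>. This recognises slices of a three-variable series as
  sides of the locality and associativity identities.\<close>

lemma series_mult_binom_exp_power:
  fixes scale :: "'k::field_char_0 \<Rightarrow> 'w::ab_group_add \<Rightarrow> 'w" and \<alpha> \<beta> :: 'k
  assumes "vector_space scale" "\<alpha> \<noteq> 0" "\<beta> \<noteq> 0"
    and G: "\<And>n i j. G (Suc n) (i, j) = scale \<alpha> (G n (i - 1, j)) + scale \<beta> (G n (i, j - 1))"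
  shows "series_mult scale (binom_exp \<alpha> \<beta> (int n)) (G 0) (i, j) = G n (i, j)"
proof -
  interpret vector_space scale by fact
  show ?thesis
  proof (induction n arbitrary: i j)
    case 0
    have "Sum_any (\<lambda>q. scale (binom_exp \<alpha> \<beta> 0 q) (G 0 ((i, j) - q))) =
        scale (binom_exp \<alpha> \<beta> 0 0) (G 0 ((i, j) - 0))"
      by (rule Sum_any_single) (auto simp: binom_exp_0 zero_prod_def)
    then show ?case by (simp add: series_mult_def binom_exp_0 zero_prod_def)
  next
    case (Suc n)
    let ?b = "binom_exp \<alpha> \<beta> (int n)"
    have fin: "finite {q. ?b (q - e) \<noteq> 0}" for e
      by (rule finite_subset[of _ "(\<lambda>q. q + e) ` {q. ?b q \<noteq> 0}"])
        (auto intro!: finite_binom_exp_power rev_image_eqI[of "_ - e"])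
    have b: "binom_exp \<alpha> \<beta> (int (Suc n)) = (\<lambda>q. \<alpha> * ?b (q - (1, 0)) + \<beta> * ?b (q - (0, 1)))"
      using binom_exp_add_one[OF assms(2,3), of "int n"] by (auto simp: add.commute)
    show ?case
      unfolding b
      by (subst series_mult_add)
        (auto intro: finite_subset[OF _ fin] simp: series_mult_scale[OF fin] G
          series_mult_shift[symmetric] Suc.IH)
  qed
qed

section \<open>Series annihilated by \<open>x - y - z\<close>\<close>

text \<open>Coefficient form of \<open>(x - y - z) T = 0\<close>.\<close>

definition jacobi_recurrence :: "(int \<times> int \<times> int \<Rightarrow> 'a::ab_group_add) \<Rightarrow> bool" where
  "jacobi_recurrence T \<longleftrightarrow> (\<forall>i j k. T (i - 1, j, k) = T (i, j - 1, k) + T (i, j, k - 1))"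

lemma jacobi_recurrenceD:
  "jacobi_recurrence T \<Longrightarrow> T (i - 1, j, k) = T (i, j - 1, k) + T (i, j, k - 1)"
  by (simp add: jacobi_recurrence_def)

lemma jacobi_recurrence_diff:
  assumes "jacobi_recurrence T" "jacobi_recurrence T'"
  shows "jacobi_recurrence (\<lambda>p. T p - T' p)"
  using assms unfolding jacobi_recurrence_def by simp

text \<open>The recurrence computes the slice at \<open>i - 1\<close> from the slice at
  \<open>i\<close>, so equality descends from one exponent of \<open>x\<close> to all lower
  ones.\<close>

lemma jacobi_recurrence_eq_fst:
  assumes T: "jacobi_recurrence T" and T': "jacobi_recurrence T'"
    and eq: "\<And>j k. T (m, j, k) = T' (m, j, k)" and "i \<le> m"
  shows "T (i, j, k) = T' (i, j, k)"
  using \<open>i \<le> m\<close>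
proof (induction arbitrary: j k rule: int_le_induct)
  case (step i)
  then show ?case by (simp add: jacobi_recurrenceD[OF T] jacobi_recurrenceD[OF T'])
qed (rule eq)

lemma jacobi_recurrence_eq_thd:
  assumes T: "jacobi_recurrence T" and T': "jacobi_recurrence T'"
    and eq: "\<And>i j. T (i, j, m) = T' (i, j, m)" and "k \<le> m"
  shows "T (i, j, k) = T' (i, j, k)"
  using \<open>k \<le> m\<close>
proof (induction arbitrary: i j rule: int_le_induct)
  case (step k)
  then show ?case
    using jacobi_recurrenceD[OF T, of i j k] jacobi_recurrenceD[OF T', of i j k] by simp
qed (rule eq)

lemma jacobi_recurrence_zero:
  assumes T: "jacobi_recurrence T"
    and fst: "\<And>i j k. i \<le> l \<Longrightarrow> T (i, j, k) = 0"
    and thd: "\<And>i j k. k \<le> m \<Longrightarrow> T (i, j, k) = 0"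
  shows "T (i, j, k) = 0"
\<comment> \<open>The measure ignores \<open>j\<close>, which grows at each step; above both bounds,
  lowering \<open>i\<close> or \<open>k\<close> by one decreases it strictly.\<close>
proof (induction "nat (i - l) + nat (k - m)" arbitrary: i j k rule: less_induct)
  case less
  show ?case
  proof (cases "i \<le> l \<or> k \<le> m")
    case False
    then have "T (i - 1, j + 1, k) = 0" "T (i, j + 1, k - 1) = 0"
      by (intro less; simp)+
    then show ?thesis
      using jacobi_recurrenceD[OF T, of i "j + 1" k] by simp
  qed (use fst thd in blast)
qed

text \<open>Since the sums are finite, \<open>(x - y - z) (w g) = ((x - y - z) w) g\<close>.\<close>

lemma (in vector_space) jacobi_recurrence_series_mult:
  assumes w: "jacobi_recurrence w"
    and fin: "\<And>p. finite {q. scale (w q) (g (p - q)) \<noteq> 0}"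
  shows "jacobi_recurrence (series_mult scale w g)"
  unfolding jacobi_recurrence_def
proof (intro allI)
  fix i j k
  have fin': "finite {q. scale (w (q - e)) (g (p - q)) \<noteq> 0}" for e p
    by (rule finite_subset[OF _ finite_imageI[OF fin[of "p - e"], of "\<lambda>q. q + e"]])
      (auto intro!: rev_image_eqI[of "_ - e"])
  have "w (q - (1, 0, 0)) = w (q - (0, 1, 0)) + w (q - (0, 0, 1))" for q
    using w by (cases q) (simp add: jacobi_recurrence_def)
  then have "series_mult scale w g ((i, j, k) - (1, 0, 0)) =
      series_mult scale w g ((i, j, k) - (0, 1, 0)) + series_mult scale w g ((i, j, k) - (0, 0, 1))"
    by (simp only: series_mult_shift series_mult_add[OF fin' fin'])
  then show "series_mult scale w g (i - 1, j, k) =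
      series_mult scale w g (i, j - 1, k) + series_mult scale w g (i, j, k - 1)"
    by simp
qed

text \<open>In each case \<open>b \<delta>(b, c) = c \<delta>(b, c)\<close>, and
  \<open>b - c\<close> is \<open>x - y - z\<close>.\<close>

lemma jacobi_recurrence_delta_exp:
  shows "jacobi_recurrence (\<lambda>(i, j, k). delta_exp 1 (-1) (i, j) k :: 'k::field_char_0)"
    and "jacobi_recurrence (\<lambda>(i, j, k). delta_exp (-1) 1 (j, i) k :: 'k::field_char_0)"
    and "jacobi_recurrence (\<lambda>(i, j, k). delta_exp 1 (-1) (i, k) j :: 'k::field_char_0)"
  using binom_exp_add_one[of "1::'k" "-1" "- _ - 1"] binom_exp_add_one[of "-1::'k" 1 "- _ - 1"]
  by (auto simp: jacobi_recurrence_def delta_exp_def)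

text \<open>Negating the upper index of the binomial produces signs that cancel those of
  \<open>- 1\<close>. In terms of residues: \<open>x^m \<delta>(x - y, z)\<close> has residue
  \<open>(z + y)^m\<close> in \<open>x\<close>.\<close>

lemma binom_exp_negated:
  "binom_exp 1 (-1) (- p - 1) (- 1 - m, k) = (binom_exp 1 1 m (p, k) :: 'k::field_char_0)"
proof (cases "0 \<le> k \<and> p + k = m")
  case True
  have "(of_int (- p - 1) :: 'k) gchoose nat k = (- 1) ^ nat k * (of_int m gchoose nat k)"
  proof -
    have "(of_int (- p - 1) :: 'k) = - (of_int p + 1)" "(of_int m :: 'k) = of_int p + 1 + of_nat (nat k) - 1"
      using True by auto
    then show ?thesis by (simp only: gbinomial_minus)
  qed
  moreover have "power_int (- 1 :: 'k) k = (- 1) ^ nat k"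
    using True by (simp add: power_int_def)
  ultimately show ?thesis
    using True by (auto simp: binom_exp_def simp flip: power_mult_distrib mult.assoc)
qed (auto simp: binom_exp_def)

lemma pole_bound:
  assumes "n + int (pole_bound Y a u) < 0"
  shows "fls_nth (Y a u) n = 0"
proof -
  let ?P = "\<lambda>N. 0 < N \<and> (\<forall>n. n + int N < 0 \<longrightarrow> fls_nth (Y a u) n = 0)"
  \<comment> \<open>The successor keeps the witness positive even when there is no pole.\<close>
  have "?P (Suc (nat (- fls_subdegree (Y a u))))"
    by (auto intro!: fls_eq0_below_subdegree)
  then have "?P (pole_bound Y a u)"
    unfolding pole_bound_def by (rule LeastI)
  with assms show ?thesis by blast
qed

section \<open>The three products of the Jacobi identity\<close>

locale jacobi_products = vector_space sW
  for sW :: "'k::field_char_0 \<Rightarrow> 'w::ab_group_add \<Rightarrow> 'w" +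
  fixes sV :: "'k \<Rightarrow> 'v::ab_group_add \<Rightarrow> 'v"
    and sM :: "'k \<Rightarrow> 'm::ab_group_add \<Rightarrow> 'm" and sN :: "'k \<Rightarrow> 'n::ab_group_add \<Rightarrow> 'n"
    and YM :: "'v \<Rightarrow> 'm \<Rightarrow> 'm fls" and YN :: "'v \<Rightarrow> 'n \<Rightarrow> 'n fls" and YW :: "'v \<Rightarrow> 'w \<Rightarrow> 'w fls"
    and F :: "'m \<Rightarrow> 'n \<Rightarrow> 'w fls"
    and a :: 'v and u :: 'm and v :: 'n
  assumes F: "bilinear_series sM sN sW F" and YW: "bilinear_series sV sW sW YW"
begin

definition T1 :: "int \<times> int \<times> int \<Rightarrow> 'w" where
  "T1 = series_mult sW (\<lambda>(i, j, k). delta_exp 1 (-1) (i, j) k)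
     (\<lambda>(i, j, k). if k = 0 then fls_nth (YW a (fls_nth (F u v) j)) i else 0)"

definition T2 :: "int \<times> int \<times> int \<Rightarrow> 'w" where
  "T2 = series_mult sW (\<lambda>(i, j, k). delta_exp (-1) 1 (j, i) k)
     (\<lambda>(i, j, k). if k = 0 then fls_nth (F u (fls_nth (YN a v) i)) j else 0)"

definition T3 :: "int \<times> int \<times> int \<Rightarrow> 'w" where
  "T3 = series_mult sW (\<lambda>(i, j, k). delta_exp 1 (-1) (i, k) j)
     (\<lambda>(i, j, k). if i = 0 then fls_nth (F (fls_nth (YM a u) k) v) j else 0)"

lemma jacobi_id_iff: "jacobi_id sW YM YN YW F a u v \<longleftrightarrow> (\<forall>p. T1 p - T2 p = T3 p)"
  by (simp add: jacobi_id_def T1_def T2_def T3_def)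

lemma recurrences: "jacobi_recurrence T1" "jacobi_recurrence T2" "jacobi_recurrence T3"
  unfolding T1_def T2_def T3_def
  by (intro jacobi_recurrence_series_mult jacobi_recurrence_delta_exp finite_jacobi[OF F YW])+

text \<open>The coefficient of \<open>z^(- 1)\<close> in \<open>\<delta>(x - y, z)\<close> is a
  zeroth power, hence \<open>1\<close>. The same applies to \<open>\<delta>(- y + x, z)\<close> in
  \<open>T2_thd\<close>.\<close>

lemma T1_thd: "T1 (i, j, - 1) = fls_nth (YW a (fls_nth (F u v) j)) i"
  unfolding T1_def series_mult_def
  by (subst Sum_any_single[of "(0, 0, - 1)"])
    (auto simp: delta_exp_def binom_exp_0 split: prod.splits if_splits)

lemma T2_thd: "T2 (i, j, - 1) = fls_nth (F u (fls_nth (YN a v) i)) j"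
  unfolding T2_def series_mult_def
  by (subst Sum_any_single[of "(0, 0, - 1)"])
    (auto simp: delta_exp_def binom_exp_0 split: prod.splits if_splits)

text \<open>The residue of \<open>\<delta>(x - z, y)\<close> in \<open>x\<close> is
  \<open>1\<close>, by \<open>binom_exp_negated\<close> with \<open>m = 0\<close>.\<close>

lemma T3_fst: "T3 (- 1, j, i) = fls_nth (F (fls_nth (YM a u) i) v) j"
proof -
  have w: "binom_exp 1 (-1) (- p - 1) (- 1, k) = (if p = 0 \<and> k = 0 then 1 else (0 :: 'k))" for p k
    using binom_exp_negated[of p 0 k] by (simp add: binom_exp_0)
  show ?thesis
    unfolding T3_def series_mult_def
    by (subst Sum_any_single[of "(- 1, 0, 0)"])
      (auto simp: delta_exp_def w split: prod.splits if_splits)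
qed

lemma T1_fst: "T1 (- 1, j, i) = shift_act sW YW a (F u v) (i, j)"
proof -
  \<comment> \<open>\<open>h (m, l)\<close> is the exponent of the delta factor whose complementary
    factor has exponent \<open>(m, l, 0)\<close>.\<close>
  define h where "h = (\<lambda>(m::int, l). (- 1 - m, j - l, i))"
  have "(x, y, i) = h (- 1 - x, j - y)" for x y
    by (simp add: h_def algebra_simps)
  then have "(x, y, i) \<in> range h" for x y
    by (rule range_eqI)
  then have range_h: "q \<in> range h \<longleftrightarrow> snd (snd q) = i" for q
    by (cases q) (auto, auto simp: h_def)
  have "inj h"
    by (auto simp: inj_def h_def)
  then show ?thesis
    unfolding T1_def series_mult_def
    by (subst Sum_any_reindex_inj[of h])
      (auto simp: range_h split: if_splits prod.splits,
        auto simp: shift_act_def h_def delta_exp_def binom_exp_negated intro!: Sum_any.cong)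
qed

text \<open>Each slice in \<open>z\<close> is \<open>x - y\<close> times the next higher one,
  starting from \<open>z^(- 1)\<close>. The variables \<open>z, x\<close> of the identity are
  \<open>x, y\<close> here.\<close>

lemma locality_id_iff:
  "locality_id sW YN YW F k a u v \<longleftrightarrow> (\<forall>i j. T1 (i, j, - int k - 1) = T2 (i, j, - int k - 1))"
proof -
  have *: "series_mult sW (binom_exp 1 (-1) (int k)) (\<lambda>(i, j). T (i, j, - 1)) (i, j) =
      T (i, j, - int k - 1)" if "jacobi_recurrence T" for T i j
    using series_mult_binom_exp_power[OF vector_space_axioms, of 1 "-1" "\<lambda>n (i, j). T (i, j, - int n - 1)" k i j]
      jacobi_recurrenceD[OF that, of _ _ "- int _ - 1"]
    by (simp add: algebra_simps)
  show ?thesis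
    using *[OF recurrences(1)] *[OF recurrences(2)]
    by (simp add: locality_id_def fun_eq_iff T1_thd T2_thd)
qed

text \<open>Each slice in \<open>x\<close> is \<open>z + y\<close> times the next higher one,
  starting from \<open>x^(- 1)\<close>. The variables \<open>z, x\<close> of the identity are
  \<open>z, y\<close> here.\<close>

lemma associativity_id_iff:
  "associativity_id sW YM YW F n a u v \<longleftrightarrow> (\<forall>j k. T1 (- int n - 1, j, k) = T3 (- int n - 1, j, k))"
proof -
  have *: "series_mult sW (binom_exp 1 1 (int n)) (\<lambda>(i, j). T (- 1, j, i)) (i, j) =
      T (- int n - 1, j, i)" if "jacobi_recurrence T" for T i j
    using series_mult_binom_exp_power[OF vector_space_axioms, of 1 1 "\<lambda>n (i, j). T (- int n - 1, j, i)" n i j]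
      jacobi_recurrenceD[OF that, of "- int _ - 1"]
    by (simp add: algebra_simps)
  have S: "shift_act sW YW a (F u v) = (\<lambda>(i, j). T1 (- 1, j, i))"
    by (auto simp: T1_fst)
  have "associativity_id sW YM YW F n a u v \<longleftrightarrow>
      (\<forall>i j. T1 (- int n - 1, j, i) = T3 (- int n - 1, j, i))"
    unfolding associativity_id_def S T3_fst[symmetric]
    by (simp only: fun_eq_iff split_paired_All * recurrences)
  then show ?thesis by blast
qed

text \<open>\<open>\<delta>(x - z, y)\<close> has only nonnegative powers of \<open>z\<close>, so
  the pole of \<open>a_z u\<close> bounds the whole product.\<close>

lemma T3_eq_0:
  assumes "k < - int (pole_bound YM a u)"
  shows "T3 (i, j, k) = 0"
proof -
  have "sW (delta_exp 1 (-1) (i', k') j') (fls_nth (F (fls_nth (YM a u) (k - k')) v) l) = 0"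
    for i' j' k' l
    using assms pole_bound[of "k - k'" YM a u]
    by (cases "0 \<le> k'") (auto simp: delta_exp_def binom_exp_def bilinear_series_zero[OF F])
  then show ?thesis
    unfolding T3_def series_mult_def by (intro Sum_any_eq_0) (auto split: prod.splits)
qed

lemma T2_eq_0:
  assumes "i < - int (pole_bound YN a v)"
  shows "T2 (i, j, k) = 0"
proof -
  have "sW (delta_exp (-1) 1 (j', i') k') (fls_nth (F u (fls_nth (YN a v) (i - i'))) l) = 0"
    for i' j' k' l
    using assms pole_bound[of "i - i'" YN a v]
    by (cases "0 \<le> i'") (auto simp: delta_exp_def binom_exp_def bilinear_series_zero[OF F])
  then show ?thesis
    unfolding T2_def series_mult_def by (intro Sum_any_eq_0) (auto split: prod.splits)
qed

lemma jacobi_id_imp: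
  assumes "jacobi_id sW YM YN YW F a u v"
  shows "associativity_id sW YM YW F (pole_bound YN a v) a u v"
    and "locality_id sW YN YW F (pole_bound YM a u) a u v"
proof -
  have J: "T1 p - T2 p = T3 p" for p
    using assms jacobi_id_iff by blast
  \<comment> \<open>This is the highest exponent of \<open>x\<close> to which \<open>T2_eq_0\<close>
    applies.\<close>
  have "T1 (- int (pole_bound YN a v) - 1, j, k) = T3 (- int (pole_bound YN a v) - 1, j, k)" for j k
    using J[of "(- int (pole_bound YN a v) - 1, j, k)"] T2_eq_0 by simp
  then show "associativity_id sW YM YW F (pole_bound YN a v) a u v"
    using associativity_id_iff by blast
  have "T1 (i, j, - int (pole_bound YM a u) - 1) = T2 (i, j, - int (pole_bound YM a u) - 1)" for i j
    using J[of "(i, j, - int (pole_bound YM a u) - 1)"] T3_eq_0 by simp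
  then show "locality_id sW YN YW F (pole_bound YM a u) a u v"
    using locality_id_iff by blast
qed

lemma imp_jacobi_id:
  assumes assoc: "associativity_id sW YM YW F n a u v" and loc: "locality_id sW YN YW F k a u v"
  shows "jacobi_id sW YM YN YW F a u v"
proof -
  define D where "D = (\<lambda>p. T1 p - T2 p - T3 p)"
  have "jacobi_recurrence D"
    unfolding D_def by (intro jacobi_recurrence_diff recurrences)
  \<comment> \<open>The first bound gives \<open>T1 = T3\<close> from associativity, the second
    gives \<open>T2 = 0\<close>.\<close>
  moreover have "D (x, y, z) = 0" if "x \<le> min (- int n - 1) (- int (pole_bound YN a v) - 1)" for x y z
  proof -
    have "T1 (x, y, z) = T3 (x, y, z)"
      using that assoc associativity_id_iff jacobi_recurrence_eq_fst[OF recurrences(1,3), of "- int n - 1"] by auto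
    with that show ?thesis by (simp add: D_def T2_eq_0)
  qed
  moreover have "D (x, y, z) = 0" if "z \<le> min (- int k - 1) (- int (pole_bound YM a u) - 1)" for x y z
  proof -
    have "T1 (x, y, z) = T2 (x, y, z)"
      using that loc locality_id_iff jacobi_recurrence_eq_thd[OF recurrences(1,2), of "- int k - 1"] by auto
    with that show ?thesis by (simp add: D_def T3_eq_0)
  qed
  ultimately have "D (x, y, z) = 0" for x y z
    by (rule jacobi_recurrence_zero)
  then show ?thesis
    by (auto simp: jacobi_id_iff D_def)
qed

end

theorem theorem4p2:
  fixes sV :: "'k::{alg_closed_field, field_char_0} \<Rightarrow> 'v::ab_group_add \<Rightarrow> 'v"
    and Y :: "'v \<Rightarrow> 'v \<Rightarrow> 'v fls" and vac :: 'v and dV :: "'v \<Rightarrow> 'v"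
    and sM :: "'k \<Rightarrow> 'm::ab_group_add \<Rightarrow> 'm" and YM :: "'v \<Rightarrow> 'm \<Rightarrow> 'm fls" and dM :: "'m \<Rightarrow> 'm"
    and sN :: "'k \<Rightarrow> 'n::ab_group_add \<Rightarrow> 'n" and YN :: "'v \<Rightarrow> 'n \<Rightarrow> 'n fls" and dN :: "'n \<Rightarrow> 'n"
    and sW :: "'k \<Rightarrow> 'w::ab_group_add \<Rightarrow> 'w" and YW :: "'v \<Rightarrow> 'w \<Rightarrow> 'w fls" and dW :: "'w \<Rightarrow> 'w"
    and F :: "'m \<Rightarrow> 'n \<Rightarrow> 'w fls"
  assumes "vertex_algebra sV Y vac dV"
    and "vertex_module sV Y vac dV sM YM dM"
    and "vertex_module sV Y vac dV sN YN dN"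
    and "vertex_module sV Y vac dV sW YW dW"
    and "bilinear_series sM sN sW F"
  shows "let
      cond1 = (derivation_compatible sW dM dN dW F \<and>
        (\<forall>a u v. \<exists>n k. associativity_id sW YM YW F n a u v \<and> locality_id sW YN YW F k a u v));
      cond2 = (derivation_compatible sW dM dN dW F \<and>
        (\<forall>a u v. associativity_id sW YM YW F (pole_bound YN a v) a u v \<and>
                 locality_id sW YN YW F (pole_bound YM a u) a u v));
      cond3 = (derivation_compatible sW dM dN dW F \<and>
        (\<exists>(n :: 'v \<Rightarrow> 'n \<Rightarrow> nat) (k :: 'v \<Rightarrow> 'm \<Rightarrow> nat). \<forall>a u v.
           associativity_id sW YM YW F (n a v) a u v \<and> locality_id sW YN YW F (k a u) a u v));
      cond4 = intertwining_operator sM YM dM sN YN dN sW YW dW F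
    in (cond1 \<longleftrightarrow> cond2) \<and> (cond2 \<longleftrightarrow> cond3) \<and> (cond3 \<longleftrightarrow> cond4)"
proof -
  have YW: "bilinear_series sV sW sW YW" and vsW: "vector_space sW"
    using assms(4) by (auto simp: vertex_module_def vertex_module_axioms_def)
  have J: "jacobi_products sW sV sM sN YW F"
    using assms(5) YW vsW by (simp add: jacobi_products_def jacobi_products_axioms_def)
  \<comment> \<open>Once the first rule turns \<open>series_deriv\<close> into
    \<open>F (dM u) v\<close>, the second is the derivation property of \<open>dW\<close>
    rearranged.\<close>
  have der: "derivation_compatible sW dM dN dW F \<longleftrightarrow>
      (\<forall>u v. fls_nth (F (dM u) v) = series_deriv sW (F u v)) \<and>
      (\<forall>u v n. dW (fls_nth (F u v) n) = fls_nth (F (dM u) v) n + fls_nth (F u (dN v)) n)"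
    by (auto simp: derivation_compatible_def algebra_simps)
  \<comment> \<open>(1) implies (4) and (4) implies (2); the pole bounds witness (3), which
    specialises to (1).\<close>
  show ?thesis
    unfolding Let_def intertwining_operator_def
    using jacobi_products.jacobi_id_imp[OF J, of YM YN] jacobi_products.imp_jacobi_id[OF J, of YM _ _ _ _ YN]
      der assms(5)
    by metis
qed

end
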